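(* Let $n\ge 1$ and let $X$ be a nonempty closed subset of $[0,1]^n$. Suppose there are a rational point $x\in X$ and a unit vector $u\in\mathbb R^n$ such that $u$ is a rational vector and $u$ is an outgoing Bouligand-Severi tangent vector to $X$ at $x$. Then the MV-algebra $\mathcal M(X)$ is not strongly semisimple.
   Context: An MV-algebra is an algebra $(A,\oplus,\neg,0)$ such that $(A,\oplus,0)$ is a commutative monoid, $\neg\neg a=a$, $a\oplus\neg 0=\neg 0$, and $\neg(\neg a\oplus b)\oplus b=\neg(\neg b\oplus a)\oplus a$ for all $a,b\in A$. Its natural order is given by $a\le b$ iff $\neg a\oplus b=\neg 0$. An ideal of $A$ is a subset containing $0$, closed under $\oplus$, and downward closed for $\le$. An ideal $I$ is proper if $I\neq A$, and maximal if it is maximal among the proper ideals. The quotient $A/I$ is the quotient by the congruence $a\sim b$ iff $\neg(\neg a\oplus b)\oplus\neg(\neg b\oplus a)\in I$. The principal ideal generated by $g\in A$ is $\{a\in A\mid a\le g\oplus\cdots\oplus g \ (k \text{ summands}) \text{ for some } k\ge 0\}$ (the empty sum being $0$). $A$ is semisimple if the intersection of all its maximal ideals is $\{0\}$ (with the empty intersection equal to $A$, so that the trivial one-element algebra counts as semisimple). $A$ is strongly semisimple if for every principal ideal $I$ of $A$ the quotient $A/I$ is semisimple. A McNaughton function on $[0,1]^n$ is a continuous function $f\colon[0,1]^n\to[0,1]$ for which there are finitely many affine functions $p_1,\dots,p_k\colon\mathbb R^n\to\mathbb R$ with integer coefficients (including the constant term) such that for every $x\in[0,1]^n$ there is $i$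 with $f(x)=p_i(x)$. $\mathcal M([0,1]^n)$ is the MV-algebra of all McNaughton functions on $[0,1]^n$ with the pointwise operations $\neg a=1-a$ and $a\oplus b=\min(1,a+b)$. For nonempty closed $X\subseteq[0,1]^n$, $\mathcal M(X)=\{f|_X\mid f\in\mathcal M([0,1]^n)\}$, with the same pointwise operations. Let $X\subseteq\mathbb R^n$ be closed, $x\in X$, and $u\in\mathbb R^n$ a unit vector (Euclidean norm $\|\cdot\|$). $u$ is a Bouligand-Severi tangent vector to $X$ at $x$ if there is a sequence $x_0,x_1,\dots$ of elements of $X$, all different from $x$, with $\lim_{i\to\infty}x_i=x$ and $\lim_{i\to\infty}(x_i-x)/\|x_i-x\|=u$. Such a $u$ is outgoing if for some $\lambda>0$ the segment $\operatorname{conv}(x,x+\lambda u)$ intersects $X$ only at $x$. A point of $\mathbb R^n$ is rational if all its coordinates are rational. A nonzero vector $w\in\mathbb R^n$ is rational if the line $\mathbb Rw$ contains at least two rational points. *)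

theory Defs
  imports "HOL-Analysis.Analysis"
begin

record 'a mv_struct =
  mv_carrier :: "'a set"
  mv_plus :: "'a \<Rightarrow> 'a \<Rightarrow> 'a" (infixl "\<oplus>\<index>" 65)
  mv_neg :: "'a \<Rightarrow> 'a" ("\<ominus>\<index> _" [81] 80)
  mv_zero :: "'a" ("\<zero>\<index>")

locale mv_algebra =
  fixes A :: "('a, 'm) mv_struct_scheme" (structure)
  assumes plus_closed: "\<lbrakk>a \<in> mv_carrier A; b \<in> mv_carrier A\<rbrakk> \<Longrightarrow> a \<oplus> b \<in> mv_carrier A"
    and neg_closed: "a \<in> mv_carrier A \<Longrightarrow> \<ominus> a \<in> mv_carrier A"
    and zero_closed: "\<zero> \<in> mv_carrier A"
    and plus_assoc: "\<lbrakk>a \<in> mv_carrier A; b \<in> mv_carrier A; c \<in> mv_carrier A\<rbrakk>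
      \<Longrightarrow> (a \<oplus> b) \<oplus> c = a \<oplus> (b \<oplus> c)"
    and plus_comm: "\<lbrakk>a \<in> mv_carrier A; b \<in> mv_carrier A\<rbrakk> \<Longrightarrow> a \<oplus> b = b \<oplus> a"
    and plus_zero: "a \<in> mv_carrier A \<Longrightarrow> a \<oplus> \<zero> = a"
    and neg_neg: "a \<in> mv_carrier A \<Longrightarrow> \<ominus> (\<ominus> a) = a"
    and plus_one: "a \<in> mv_carrier A \<Longrightarrow> a \<oplus> \<ominus> \<zero> = \<ominus> \<zero>"
    and lukasiewicz: "\<lbrakk>a \<in> mv_carrier A; b \<in> mv_carrier A\<rbrakk>
      \<Longrightarrow> \<ominus> (\<ominus> a \<oplus> b) \<oplus> b = \<ominus> (\<ominus> b \<oplus> a) \<oplus> a"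

definition mv_le :: "('a, 'm) mv_struct_scheme \<Rightarrow> 'a \<Rightarrow> 'a \<Rightarrow> bool" where
  "mv_le A a b \<longleftrightarrow> \<ominus>\<^bsub>A\<^esub> a \<oplus>\<^bsub>A\<^esub> b = \<ominus>\<^bsub>A\<^esub> \<zero>\<^bsub>A\<^esub>"

definition mv_ideal :: "('a, 'm) mv_struct_scheme \<Rightarrow> 'a set \<Rightarrow> bool" where
  "mv_ideal A I \<longleftrightarrow> I \<subseteq> mv_carrier A \<and> \<zero>\<^bsub>A\<^esub> \<in> I
     \<and> (\<forall>a\<in>I. \<forall>b\<in>I. a \<oplus>\<^bsub>A\<^esub> b \<in> I)
     \<and> (\<forall>a\<in>mv_carrier A. \<forall>b\<in>I. mv_le A a b \<longrightarrow> a \<in> I)"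

definition mv_proper_ideal :: "('a, 'm) mv_struct_scheme \<Rightarrow> 'a set \<Rightarrow> bool" where
  "mv_proper_ideal A I \<longleftrightarrow> mv_ideal A I \<and> I \<noteq> mv_carrier A"

definition mv_maximal_ideal :: "('a, 'm) mv_struct_scheme \<Rightarrow> 'a set \<Rightarrow> bool" where
  "mv_maximal_ideal A M \<longleftrightarrow> mv_proper_ideal A M
     \<and> (\<forall>J. mv_proper_ideal A J \<and> M \<subseteq> J \<longrightarrow> J = M)"

definition mv_cong :: "('a, 'm) mv_struct_scheme \<Rightarrow> 'a set \<Rightarrow> ('a \<times> 'a) set" where
  "mv_cong A I = {(a, b). a \<in> mv_carrier A \<and> b \<in> mv_carrier A
     \<and> \<ominus>\<^bsub>A\<^esub> (\<ominus>\<^bsub>A\<^esub> a \<oplus>\<^bsub>A\<^esub> b) \<oplus>\<^bsub>A\<^esub> \<ominus>\<^bsub>A\<^esub> (\<ominus>\<^bsub>A\<^esub> b \<oplus>\<^bsub>A\<^esub> a) \<in> I}"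

text \<open>The elements of the quotient are equivalence classes.  When \<open>A\<close> is an MV-algebra and
  \<open>I\<close> an ideal, \<^term>\<open>mv_cong A I\<close> is a congruence, so all classes in the unions below coincide and each union is the class of
  the result of the operation on arbitrary representatives.\<close>

definition mv_quot :: "('a, 'm) mv_struct_scheme \<Rightarrow> 'a set \<Rightarrow> 'a set mv_struct" where
  "mv_quot A I = \<lparr>
     mv_carrier = mv_carrier A // mv_cong A I,
     mv_plus = (\<lambda>C D. \<Union>a\<in>C. \<Union>b\<in>D. mv_cong A I `` {a \<oplus>\<^bsub>A\<^esub> b}),
     mv_neg = (\<lambda>C. \<Union>a\<in>C. mv_cong A I `` {\<ominus>\<^bsub>A\<^esub> a}),
     mv_zero = mv_cong A I `` {\<zero>\<^bsub>A\<^esub>}\<rparr>"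

primrec mv_mult :: "('a, 'm) mv_struct_scheme \<Rightarrow> nat \<Rightarrow> 'a \<Rightarrow> 'a" where
  "mv_mult A 0 g = \<zero>\<^bsub>A\<^esub>"
| "mv_mult A (Suc k) g = mv_mult A k g \<oplus>\<^bsub>A\<^esub> g"

definition mv_principal :: "('a, 'm) mv_struct_scheme \<Rightarrow> 'a \<Rightarrow> 'a set" where
  "mv_principal A g = {a \<in> mv_carrier A. \<exists>k. mv_le A a (mv_mult A k g)}"

text \<open>The set below is the intersection of all maximal ideals, taken inside the carrier, so
  that it is the whole carrier when there are no maximal ideals.\<close>

definition mv_semisimple :: "('a, 'm) mv_struct_scheme \<Rightarrow> bool" where
  "mv_semisimple A \<longleftrightarrow>
     {a \<in> mv_carrier A. \<forall>M. mv_maximal_ideal A M \<longrightarrow> a \<in> M} = {\<zero>\<^bsub>A\<^esub>}"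

definition mv_strongly_semisimple :: "('a, 'm) mv_struct_scheme \<Rightarrow> bool" where
  "mv_strongly_semisimple A \<longleftrightarrow>
     (\<forall>g\<in>mv_carrier A. mv_semisimple (mv_quot A (mv_principal A g)))"

definition unit_cube :: "(real ^ 'n) set" where
  "unit_cube = {x. \<forall>i. 0 \<le> x $ i \<and> x $ i \<le> 1}"

definition integer_affine :: "(real ^ 'n \<Rightarrow> real) \<Rightarrow> bool" where
  "integer_affine p \<longleftrightarrow> (\<exists>(c :: 'n \<Rightarrow> int) (d :: int).
     \<forall>x. p x = (\<Sum>i\<in>UNIV. of_int (c i) * x $ i) + of_int d)"

text \<open>Functions on a set \<open>X\<close> are represented as extensional functions, that is, functions
  with the value \<^term>\<open>undefined\<close> outside \<open>X\<close>; thus equality of such functions is equality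
  on \<open>X\<close>.\<close>

definition mcnaughton :: "(real ^ 'n \<Rightarrow> real) set" where
  "mcnaughton = {f \<in> unit_cube \<rightarrow>\<^sub>E {0..1}. continuous_on unit_cube f
     \<and> (\<exists>P. finite P \<and> (\<forall>p\<in>P. integer_affine p) \<and> (\<forall>x\<in>unit_cube. \<exists>p\<in>P. f x = p x))}"

definition mcnaughton_algebra :: "(real ^ 'n) set \<Rightarrow> (real ^ 'n \<Rightarrow> real) mv_struct" where
  "mcnaughton_algebra X = \<lparr>
     mv_carrier = (\<lambda>f. restrict f X) ` mcnaughton,
     mv_plus = (\<lambda>a b. \<lambda>x\<in>X. min 1 (a x + b x)),
     mv_neg = (\<lambda>a. \<lambda>x\<in>X. 1 - a x),
     mv_zero = (\<lambda>x\<in>X. 0)\<rparr>"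

lemma integer_affine_const: "integer_affine (\<lambda>x. of_int d)"
  unfolding integer_affine_def by (rule exI[of _ "\<lambda>i. 0"]) auto

lemma integer_affine_add:
  assumes "integer_affine p" "integer_affine q"
  shows "integer_affine (\<lambda>x. p x + q x)"
proof -
  obtain c d c' d' where
    "\<And>x. p x = (\<Sum>i\<in>UNIV. of_int (c i) * x $ i) + of_int d"
    "\<And>x. q x = (\<Sum>i\<in>UNIV. of_int (c' i) * x $ i) + of_int d'"
    using assms unfolding integer_affine_def by metis
  then show ?thesis
    unfolding integer_affine_def
    by (intro exI[of _ "\<lambda>i. c i + c' i"] exI[of _ "d + d'"])
      (simp add: sum.distrib distrib_right)
qed

lemma integer_affine_neg:
  assumes "integer_affine p"
  shows "integer_affine (\<lambda>x. 1 - p x)"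
proof -
  obtain c d where "\<And>x. p x = (\<Sum>i\<in>UNIV. of_int (c i) * x $ i) + of_int d"
    using assms unfolding integer_affine_def by metis
  then show ?thesis
    unfolding integer_affine_def
    by (intro exI[of _ "\<lambda>i. - c i"] exI[of _ "1 - d"]) (simp add: sum_negf)
qed

lemma mcnaughton_zero: "(\<lambda>x\<in>unit_cube. 0) \<in> mcnaughton"
proof -
  have "integer_affine (\<lambda>x. 0)"
    using integer_affine_const[of 0] by simp
  then show ?thesis
    unfolding mcnaughton_def
    by (auto intro!: exI[of _ "{\<lambda>x. 0}"] simp: continuous_on_const cong: continuous_on_cong)
qed

lemma mcnaughton_neg:
  assumes "f \<in> mcnaughton"
  shows "(\<lambda>x\<in>unit_cube. 1 - f x) \<in> mcnaughton"
proof -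
  obtain P where P: "finite P" "\<forall>p\<in>P. integer_affine p" "\<forall>x\<in>unit_cube. \<exists>p\<in>P. f x = p x"
    using assms unfolding mcnaughton_def by blast
  let ?Q = "(\<lambda>p x. 1 - p x) ` P"
  have "finite ?Q" "\<forall>q\<in>?Q. integer_affine q"
    using P integer_affine_neg by auto
  moreover have "\<forall>x\<in>unit_cube. \<exists>q\<in>?Q. restrict (\<lambda>x. 1 - f x) unit_cube x = q x"
    using P(3) by auto
  moreover have "continuous_on unit_cube (\<lambda>x\<in>unit_cube. 1 - f x)"
    using assms unfolding mcnaughton_def
    by (auto intro!: continuous_intros cong: continuous_on_cong)
  ultimately show ?thesis
    using assms unfolding mcnaughton_def by (auto simp: PiE_iff)
qed

lemma mcnaughton_plus:
  fixes f g :: "real ^ 'n \<Rightarrow> real"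
  assumes "f \<in> mcnaughton" "g \<in> mcnaughton"
  shows "(\<lambda>x\<in>unit_cube. min 1 (f x + g x)) \<in> mcnaughton"
proof -
  obtain P where P: "finite P" "\<forall>p\<in>P. integer_affine p" "\<forall>x\<in>unit_cube. \<exists>p\<in>P. f x = p x"
    using assms unfolding mcnaughton_def by blast
  obtain P' where P': "finite P'" "\<forall>p\<in>P'. integer_affine p" "\<forall>x\<in>unit_cube. \<exists>p\<in>P'. g x = p x"
    using assms unfolding mcnaughton_def by blast
  let ?Q = "insert (\<lambda>x. 1) ((\<lambda>(p, q) x. p x + q x) ` (P \<times> P'))"
  have "finite ?Q" "\<forall>q\<in>?Q. integer_affine q"
    using P P' integer_affine_const[of 1] by (auto intro!: integer_affine_add)
  moreover have "\<forall>x\<in>unit_cube. \<exists>q\<in>?Q. restrict (\<lambda>x. min 1 (f x + g x)) unit_cube x = q x"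
  proof
    fix x assume x: "x \<in> (unit_cube :: (real ^ 'n) set)"
    obtain p q where "p \<in> P" "f x = p x" "q \<in> P'" "g x = q x"
      using P(3) P'(3) x by blast
    then show "\<exists>q\<in>?Q. restrict (\<lambda>x. min 1 (f x + g x)) unit_cube x = q x"
      using x by (cases "1 \<le> f x + g x") (auto simp: min_def intro!: bexI[of _ "(p, q)"])
  qed
  moreover have "continuous_on unit_cube (\<lambda>x\<in>unit_cube. min 1 (f x + g x))"
    using assms unfolding mcnaughton_def
    by (auto intro!: continuous_intros cong: continuous_on_cong)
  ultimately show ?thesis
    using assms unfolding mcnaughton_def by (auto simp: PiE_iff intro!: add_nonneg_nonneg)
qed

lemma mv_algebra_mcnaughton_algebra:
  assumes "X \<subseteq> unit_cube"
  shows "mv_algebra (mcnaughton_algebra X)"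
proof -
  let ?C = "(\<lambda>f. restrict f X) ` mcnaughton"
  have plus: "(\<lambda>x\<in>X. min 1 (a x + b x)) \<in> ?C" if "a \<in> ?C" "b \<in> ?C" for a b
  proof -
    obtain f g where "f \<in> mcnaughton" "g \<in> mcnaughton" "a = restrict f X" "b = restrict g X"
      using \<open>a \<in> ?C\<close> \<open>b \<in> ?C\<close> by blast
    then show ?thesis
      using assms by (intro image_eqI[OF _ mcnaughton_plus[of f g]]) (auto simp: restrict_def fun_eq_iff)
  qed
  have neg: "(\<lambda>x\<in>X. 1 - a x) \<in> ?C" if "a \<in> ?C" for a
  proof -
    obtain f where "f \<in> mcnaughton" "a = restrict f X"
      using \<open>a \<in> ?C\<close> by blast
    then show ?thesis
      using assms by (intro image_eqI[OF _ mcnaughton_neg[of f]]) (auto simp: restrict_def fun_eq_iff)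
  qed
  have zero: "(\<lambda>x\<in>X. 0) \<in> ?C"
    using assms by (intro image_eqI[OF _ mcnaughton_zero]) (auto simp: restrict_def fun_eq_iff)
  have ext: "a x = undefined" if "a \<in> ?C" "x \<notin> X" for a x
    using that by auto
  have range: "0 \<le> a x \<and> a x \<le> 1" if "a \<in> ?C" "x \<in> X" for a x
    using that assms unfolding mcnaughton_def by (fastforce simp: PiE_iff)
  have simps: "mv_carrier (mcnaughton_algebra X) = ?C"
    "mv_plus (mcnaughton_algebra X) = (\<lambda>a b. \<lambda>x\<in>X. min 1 (a x + b x))"
    "mv_neg (mcnaughton_algebra X) = (\<lambda>a. \<lambda>x\<in>X. 1 - a x)"
    "mv_zero (mcnaughton_algebra X) = (\<lambda>x\<in>X. 0)"
    by (simp_all add: mcnaughton_algebra_def)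
  show ?thesis
  proof (unfold_locales, unfold simps)
    fix a b c assume a: "a \<in> ?C"
    note ra = range[OF a] and ea = ext[OF a]
    show "(\<lambda>x\<in>X. 1 - a x) \<in> ?C"
      using a by (rule neg)
    show "(\<lambda>x\<in>X. min 1 (a x + (\<lambda>x\<in>X. 0) x)) = a"
    proof
      fix x show "(\<lambda>x\<in>X. min 1 (a x + (\<lambda>x\<in>X. 0) x)) x = a x"
        using ra[of x] ea[of x] by (cases "x \<in> X") auto
    qed
    show "(\<lambda>x\<in>X. 1 - (\<lambda>x\<in>X. 1 - a x) x) = a"
    proof
      fix x show "(\<lambda>x\<in>X. 1 - (\<lambda>x\<in>X. 1 - a x) x) x = a x"
        using ea[of x] by (cases "x \<in> X") auto
    qed
    show "(\<lambda>x\<in>X. min 1 (a x + (\<lambda>x\<in>X. 1 - (\<lambda>x\<in>X. 0) x) x)) = (\<lambda>x\<in>X. 1 - (\<lambda>x\<in>X. 0) x)"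
      using ra by (intro restrict_ext) auto
    assume b: "b \<in> ?C"
    note rb = range[OF b]
    show "(\<lambda>x\<in>X. min 1 (a x + b x)) \<in> ?C"
      using a b by (rule plus)
    show "(\<lambda>x\<in>X. min 1 (a x + b x)) = (\<lambda>x\<in>X. min 1 (b x + a x))"
      by (simp add: add.commute)
    show "(\<lambda>x\<in>X. min 1 ((\<lambda>x\<in>X. 1 - (\<lambda>x\<in>X. min 1 ((\<lambda>x\<in>X. 1 - a x) x + b x)) x) x + b x))
        = (\<lambda>x\<in>X. min 1 ((\<lambda>x\<in>X. 1 - (\<lambda>x\<in>X. min 1 ((\<lambda>x\<in>X. 1 - b x) x + a x)) x) x + a x))"
      using ra rb by (intro restrict_ext) (auto simp: min_def)
    assume c: "c \<in> ?C"
    show "(\<lambda>x\<in>X. min 1 ((\<lambda>x\<in>X. min 1 (a x + b x)) x + c x))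
        = (\<lambda>x\<in>X. min 1 (a x + (\<lambda>x\<in>X. min 1 (b x + c x)) x))"
    proof (rule restrict_ext)
      fix x assume "x \<in> X"
      then show "min 1 ((\<lambda>x\<in>X. min 1 (a x + b x)) x + c x)
          = min 1 (a x + (\<lambda>x\<in>X. min 1 (b x + c x)) x)"
        using ra[of x] rb[of x] range[OF c, of x] by (simp add: min_def)
    qed
  qed (rule zero)
qed

definition bs_tangent :: "(real ^ 'n) set \<Rightarrow> real ^ 'n \<Rightarrow> real ^ 'n \<Rightarrow> bool" where
  "bs_tangent X x u \<longleftrightarrow> norm u = 1 \<and>
     (\<exists>s :: nat \<Rightarrow> real ^ 'n. (\<forall>i. s i \<in> X \<and> s i \<noteq> x) \<and> s \<longlonglongrightarrow> x
        \<and> (\<lambda>i. (s i - x) /\<^sub>R norm (s i - x)) \<longlonglongrightarrow> u)"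

definition outgoing :: "(real ^ 'n) set \<Rightarrow> real ^ 'n \<Rightarrow> real ^ 'n \<Rightarrow> bool" where
  "outgoing X x u \<longleftrightarrow> (\<exists>l>0. convex hull {x, x + l *\<^sub>R u} \<inter> X = {x})"

definition rational_point :: "real ^ 'n \<Rightarrow> bool" where
  "rational_point x \<longleftrightarrow> (\<forall>i. x $ i \<in> \<rat>)"

definition rational_vector :: "real ^ 'n \<Rightarrow> bool" where
  "rational_vector w \<longleftrightarrow> w \<noteq> 0 \<and>
     (\<exists>p\<in>range (\<lambda>t. t *\<^sub>R w). \<exists>q\<in>range (\<lambda>t. t *\<^sub>R w).
        p \<noteq> q \<and> rational_point p \<and> rational_point q)"

end

theory Submission imports Defs begin

text \<open>Choose a piecewise affine function \<open>F\<close> vanishing only at \<open>x\<close> and growing at least like the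
  distance to \<open>x\<close>, and another one \<open>G\<close> whose zero set is a segment starting at \<open>x\<close> in direction \<open>u\<close>
  that meets \<open>X\<close> only at \<open>x\<close>; the rationality of \<open>x\<close> and \<open>u\<close> is what allows integer coefficients.
  Along a sequence in \<open>X\<close> tangent to \<open>u\<close>, \<open>G\<close> is of smaller order than \<open>F\<close>, so \<open>F\<close> is not in the
  ideal generated by \<open>G\<close>. The Lukasiewicz product of \<open>k F\<close> and \<open>F\<close> vanishes near \<open>x\<close> and is bounded by
  a multiple of \<open>G\<close> on the rest of the compact set \<open>X\<close>. Hence the class of \<open>F\<close> modulo \<open>G\<close> is a
  nonzero infinitesimal, and infinitesimals lie in every maximal ideal.\<close>

section \<open>MV-algebras of functions with values in [0,1]: pointwise order and multiples\<close>

locale mv_function_algebra = mv_algebra A for A :: "('a \<Rightarrow> real) mv_struct" (structure) +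
  fixes X :: "'a set"
  assumes carrier_subset: "mv_carrier A \<subseteq> X \<rightarrow>\<^sub>E {0..1}"
    and plus_eq: "a \<oplus> b = (\<lambda>x\<in>X. min 1 (a x + b x))"
    and neg_eq: "\<ominus> a = (\<lambda>x\<in>X. 1 - a x)"
    and zero_eq: "\<zero> = (\<lambda>x\<in>X. 0)"
begin

lemma carrier_bounds:
  assumes "a \<in> mv_carrier A" "x \<in> X"
  shows "0 \<le> a x" "a x \<le> 1"
  using carrier_subset assms by (auto simp: PiE_iff subset_iff)

lemma apply_simps [simp]:
  assumes "x \<in> X"
  shows "(a \<oplus> b) x = min 1 (a x + b x)" "(\<ominus> a) x = 1 - a x" "\<zero> x = 0"
  using assms by (auto simp: plus_eq neg_eq zero_eq)

lemma carrier_eqI: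
  assumes "a \<in> mv_carrier A" "b \<in> mv_carrier A" "\<And>x. x \<in> X \<Longrightarrow> a x = b x"
  shows "a = b"
  using assms carrier_subset by (intro PiE_ext[where k = X and s = "\<lambda>_. {0..1}"]) auto

lemma le_iff:
  assumes "a \<in> mv_carrier A" "b \<in> mv_carrier A"
  shows "mv_le A a b \<longleftrightarrow> (\<forall>x\<in>X. a x \<le> b x)"
proof
  assume "mv_le A a b"
  then have "\<ominus> a \<oplus> b = \<ominus> \<zero>" by (simp add: mv_le_def)
  then have eq: "(\<ominus> a \<oplus> b) x = (\<ominus> \<zero>) x" for x by simp
  show "\<forall>x\<in>X. a x \<le> b x"
  proof
    fix x assume "x \<in> X"
    then show "a x \<le> b x" using eq[of x] by (simp add: min_def split: if_splits)
  qed
next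
  assume "\<forall>x\<in>X. a x \<le> b x"
  then show "mv_le A a b"
    unfolding mv_le_def using assms
    by (intro carrier_eqI) (auto simp: plus_closed neg_closed zero_closed)
qed

lemma mult_closed:
  assumes "g \<in> mv_carrier A"
  shows "mv_mult A k g \<in> mv_carrier A"
  using assms by (induction k) (auto simp: zero_closed plus_closed)

text \<open>Since \<open>g x\<close> is nonnegative, truncating at 1 after every summand gives the
  same value as truncating once at the end.\<close>

lemma mult_apply:
  assumes "g \<in> mv_carrier A" "x \<in> X"
  shows "mv_mult A k g x = min 1 (real k * g x)"
proof (induction k)
  case (Suc k)
  then show ?case
    using assms carrier_bounds[OF assms] by (auto simp: min_def algebra_simps)
qed (use assms in auto)

section \<open>Ideals and ideals generated by adjoining an element\<close>

lemma ideal_downward: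
  assumes "mv_ideal A J" "b \<in> J" "a \<in> mv_carrier A" "\<And>x. x \<in> X \<Longrightarrow> a x \<le> b x"
  shows "a \<in> J"
proof -
  have "b \<in> mv_carrier A" using assms by (auto simp: mv_ideal_def)
  then show ?thesis using assms le_iff[of a b] by (auto simp: mv_ideal_def)
qed

lemma ideal_plus: "mv_ideal A J \<Longrightarrow> a \<in> J \<Longrightarrow> b \<in> J \<Longrightarrow> a \<oplus> b \<in> J"
  by (auto simp: mv_ideal_def)

lemma ideal_zero: "mv_ideal A J \<Longrightarrow> \<zero> \<in> J"
  by (auto simp: mv_ideal_def)

lemma ideal_carrier: "mv_ideal A J \<Longrightarrow> a \<in> J \<Longrightarrow> a \<in> mv_carrier A"
  by (auto simp: mv_ideal_def)

text \<open>For an ideal \<open>J\<close> this is the ideal generated by \<open>J\<close> and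
  \<open>f\<close>. The bound uses ordinary real sums and multiples: as \<open>h\<close> is at most
  1, truncating the right-hand side would not change the condition.\<close>

definition ideal_adjoin :: "('a \<Rightarrow> real) set \<Rightarrow> ('a \<Rightarrow> real) \<Rightarrow> ('a \<Rightarrow> real) set" where
  "ideal_adjoin J f = {h \<in> mv_carrier A. \<exists>b\<in>J. \<exists>k. \<forall>x\<in>X. h x \<le> b x + real k * f x}"

lemma ideal_ideal_adjoin:
  assumes J: "mv_ideal A J" and f: "f \<in> mv_carrier A"
  shows "mv_ideal A (ideal_adjoin J f)"
  unfolding mv_ideal_def
proof (intro conjI ballI impI)
  show "ideal_adjoin J f \<subseteq> mv_carrier A" by (auto simp: ideal_adjoin_def)
  show "\<zero> \<in> ideal_adjoin J f"
    using ideal_zero[OF J] zero_closed unfolding ideal_adjoin_def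
    by (auto intro!: bexI[of _ \<zero>] exI[of _ 0])
next
  fix a b assume "a \<in> ideal_adjoin J f" "b \<in> ideal_adjoin J f"
  then obtain c d k l where ab: "a \<in> mv_carrier A" "b \<in> mv_carrier A" "c \<in> J" "d \<in> J"
    "\<And>x. x \<in> X \<Longrightarrow> a x \<le> c x + real k * f x" "\<And>x. x \<in> X \<Longrightarrow> b x \<le> d x + real l * f x"
    unfolding ideal_adjoin_def by blast
  have "(a \<oplus> b) x \<le> (c \<oplus> d) x + real (k + l) * f x" if "x \<in> X" for x
  proof -
    have "0 \<le> real (k + l) * f x"
      using carrier_bounds[OF f that] by simp
    then show ?thesis
      using ab(5,6)[OF that] that by (simp add: min_def algebra_simps)
  qed
  then show "a \<oplus> b \<in> ideal_adjoin J f"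
    unfolding ideal_adjoin_def using ab plus_closed ideal_plus[OF J] by blast
next
  fix a b assume ab: "a \<in> mv_carrier A" "b \<in> ideal_adjoin J f" "mv_le A a b"
  then have "\<forall>x\<in>X. a x \<le> b x" using le_iff by (auto simp: ideal_adjoin_def)
  with ab show "a \<in> ideal_adjoin J f"
    unfolding ideal_adjoin_def by (blast intro: order_trans)
qed

lemma subset_ideal_adjoin:
  assumes "mv_ideal A J"
  shows "J \<subseteq> ideal_adjoin J f"
proof
  fix b assume "b \<in> J"
  then have "b \<in> mv_carrier A" "\<forall>x\<in>X. b x \<le> b x + real 0 * f x"
    using ideal_carrier[OF assms] by auto
  with \<open>b \<in> J\<close> show "b \<in> ideal_adjoin J f"
    unfolding ideal_adjoin_def by blast
qed

lemma mem_ideal_adjoin: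
  assumes "mv_ideal A J" "f \<in> mv_carrier A"
  shows "f \<in> ideal_adjoin J f"
  using assms ideal_zero[OF assms(1)] unfolding ideal_adjoin_def
  by (auto intro!: bexI[of _ \<zero>] exI[of _ 1])

lemma principal_eq_adjoin:
  assumes g: "g \<in> mv_carrier A"
  shows "mv_principal A g = ideal_adjoin {\<zero>} g"
proof -
  have "mv_le A a (mv_mult A k g) \<longleftrightarrow> (\<forall>x\<in>X. a x \<le> \<zero> x + real k * g x)"
    if "a \<in> mv_carrier A" for a k
    using that g carrier_bounds(2)[OF that]
    by (auto simp: le_iff mult_closed mult_apply)
  then show ?thesis
    unfolding mv_principal_def ideal_adjoin_def by auto
qed

lemma ideal_singleton_zero: "mv_ideal A {\<zero>}"
proof -
  have "a = \<zero>" if "a \<in> mv_carrier A" "mv_le A a \<zero>" for a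
    using that carrier_bounds(1)[OF that(1)]
    by (intro carrier_eqI) (force simp: le_iff zero_closed)+
  then show ?thesis
    unfolding mv_ideal_def using zero_closed plus_zero by auto
qed

lemma ideal_principal: "g \<in> mv_carrier A \<Longrightarrow> mv_ideal A (mv_principal A g)"
  using ideal_ideal_adjoin[OF ideal_singleton_zero] principal_eq_adjoin by simp

lemma mem_principal_iff:
  assumes "g \<in> mv_carrier A"
  shows "a \<in> mv_principal A g \<longleftrightarrow>
    a \<in> mv_carrier A \<and> (\<exists>k. \<forall>x\<in>X. a x \<le> real k * g x)"
  unfolding principal_eq_adjoin[OF assms] ideal_adjoin_def by auto

text \<open>This is Chang's distance, the term that occurs in \<open>mv_cong\<close>.\<close>

definition diff :: "('a \<Rightarrow> real) \<Rightarrow> ('a \<Rightarrow> real) \<Rightarrow> ('a \<Rightarrow> real)" where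
  "diff a b = \<ominus> (\<ominus> a \<oplus> b) \<oplus> \<ominus> (\<ominus> b \<oplus> a)"

lemma diff_closed: "a \<in> mv_carrier A \<Longrightarrow> b \<in> mv_carrier A \<Longrightarrow> diff a b \<in> mv_carrier A"
  by (simp add: diff_def plus_closed neg_closed)

lemma diff_apply:
  assumes "a \<in> mv_carrier A" "b \<in> mv_carrier A" "x \<in> X"
  shows "diff a b x = \<bar>a x - b x\<bar>"
  using assms(3) carrier_bounds[OF assms(1,3)] carrier_bounds[OF assms(2,3)]
  by (auto simp: diff_def min_def abs_if)

lemma cong_iff:
  "(a, b) \<in> mv_cong A I \<longleftrightarrow> a \<in> mv_carrier A \<and> b \<in> mv_carrier A \<and> diff a b \<in> I"
  by (simp add: mv_cong_def diff_def)

section \<open>The quotient by an ideal: classes, operations, order and ideals\<close>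

context
  fixes I assumes I: "mv_ideal A I"
begin

abbreviation "cls a \<equiv> mv_cong A I `` {a}"
abbreviation "Q \<equiv> mv_quot A I"

text \<open>Ideals are downward closed, so any member of \<open>I\<close> that dominates the
  distance is a certificate of congruence. This turns congruence proofs into inequalities between
  reals.\<close>

lemma congI:
  assumes "a \<in> mv_carrier A" "b \<in> mv_carrier A" "c \<in> I"
    and "\<And>x. x \<in> X \<Longrightarrow> \<bar>a x - b x\<bar> \<le> c x"
  shows "(a, b) \<in> mv_cong A I"
  unfolding cong_iff using assms
  by (auto intro!: ideal_downward[OF I assms(3)] simp: diff_closed diff_apply)

lemma equiv_cong: "equiv (mv_carrier A) (mv_cong A I)"
proof (rule equivI)
  show "mv_cong A I \<subseteq> mv_carrier A \<times> mv_carrier A" by (auto simp: cong_iff)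
  show "refl_on (mv_carrier A) (mv_cong A I)"
    using congI[OF _ _ ideal_zero[OF I]] by (auto simp: refl_on_def)
  show "sym (mv_cong A I)"
  proof (rule symI)
    fix a b assume "(a, b) \<in> mv_cong A I"
    then show "(b, a) \<in> mv_cong A I"
      by (intro congI[of _ _ "diff a b"]) (auto simp: cong_iff diff_apply)
  qed
  show "trans (mv_cong A I)"
  proof (rule transI)
    fix a b c assume *: "(a, b) \<in> mv_cong A I" "(b, c) \<in> mv_cong A I"
    \<comment> \<open>The triangle inequality survives the truncated sum because the distance of
      \<open>a\<close> and \<open>c\<close> is at most 1.\<close>
    show "(a, c) \<in> mv_cong A I"
    proof (rule congI[of _ _ "diff a b \<oplus> diff b c"])
      fix x assume x: "x \<in> X"
      have "a \<in> mv_carrier A" "b \<in> mv_carrier A" "c \<in> mv_carrier A"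
        using * by (auto simp: cong_iff)
      then show "\<bar>a x - c x\<bar> \<le> (diff a b \<oplus> diff b c) x"
        using x carrier_bounds[of a x] carrier_bounds[of c x] by (auto simp: diff_apply)
    qed (use * ideal_plus[OF I] in \<open>auto simp: cong_iff\<close>)
  qed
qed

lemma cls_eq_iff:
  "a \<in> mv_carrier A \<Longrightarrow> b \<in> mv_carrier A \<Longrightarrow> cls a = cls b \<longleftrightarrow> (a, b) \<in> mv_cong A I"
  using eq_equiv_class_iff[OF equiv_cong] by blast

lemma quot_carrier: "mv_carrier Q = cls ` mv_carrier A"
  by (auto simp: mv_quot_def quotient_def)

lemma quot_zero: "mv_zero Q = cls \<zero>"
  by (simp add: mv_quot_def)

text \<open>Negation preserves the distance, so all classes in the union that defines the operation
  coincide.\<close>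

lemma quot_neg:
  assumes "a \<in> mv_carrier A"
  shows "mv_neg Q (cls a) = cls (\<ominus> a)"
proof -
  have "cls (\<ominus> a') = cls (\<ominus> a)" if "a' \<in> cls a" for a'
  proof -
    have "(\<ominus> a', \<ominus> a) \<in> mv_cong A I"
      using that by (intro congI[of _ _ "diff a a'"]) (auto simp: cong_iff neg_closed diff_apply)
    then show ?thesis using equiv_class_eq[OF equiv_cong] by blast
  qed
  moreover have "a \<in> cls a" using equiv_class_self[OF equiv_cong assms] .
  ultimately have "(\<Union>a'\<in>cls a. cls (\<ominus> a')) = cls (\<ominus> a)"
    by blast
  then show ?thesis by (simp add: mv_quot_def)
qed

text \<open>Truncated addition does not expand distances: the distance of two sums is at most the
  sum of the distances of the summands. Hence the union in the definition runs over a single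
  class.\<close>

lemma quot_plus:
  assumes "a \<in> mv_carrier A" "b \<in> mv_carrier A"
  shows "mv_plus Q (cls a) (cls b) = cls (a \<oplus> b)"
proof -
  have "cls (a' \<oplus> b') = cls (a \<oplus> b)" if "a' \<in> cls a" "b' \<in> cls b" for a' b'
  proof -
    have "(a' \<oplus> b', a \<oplus> b) \<in> mv_cong A I"
    proof (intro congI[of _ _ "diff a a' \<oplus> diff b b'"])
      fix x assume "x \<in> X"
      moreover have "a' \<in> mv_carrier A" "b' \<in> mv_carrier A"
        using that by (auto simp: cong_iff)
      ultimately show "\<bar>(a' \<oplus> b') x - (a \<oplus> b) x\<bar> \<le> (diff a a' \<oplus> diff b b') x"
        using assms carrier_bounds[of a x] carrier_bounds[of b x]
          carrier_bounds[of a' x] carrier_bounds[of b' x]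
        by (auto simp: diff_apply min_def)
    qed (use that ideal_plus[OF I] in \<open>auto simp: cong_iff plus_closed\<close>)
    then show ?thesis using equiv_class_eq[OF equiv_cong] by blast
  qed
  moreover have "a \<in> cls a" "b \<in> cls b"
    using equiv_class_self[OF equiv_cong] assms by auto
  ultimately have "(\<Union>a'\<in>cls a. \<Union>b'\<in>cls b. cls (a' \<oplus> b')) = cls (a \<oplus> b)"
    by blast
  then show ?thesis by (simp add: mv_quot_def)
qed

lemma quot_leI:
  assumes "a \<in> mv_carrier A" "b \<in> mv_carrier A" "\<And>x. x \<in> X \<Longrightarrow> a x \<le> b x"
  shows "mv_le Q (cls a) (cls b)"
proof -
  have "\<ominus> a \<oplus> b = \<ominus> \<zero>"
    using le_iff[OF assms(1,2)] assms(3) by (auto simp: mv_le_def)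
  then show ?thesis
    using assms by (simp add: mv_le_def quot_neg quot_plus quot_zero neg_closed zero_closed)
qed

text \<open>Order in the quotient is pointwise order up to an error in \<open>I\<close>. The error
  is the distance of \<open>\<ominus> a \<oplus> b\<close> from the top element, which at
  \<open>x\<close> equals \<open>max 0 (a x - b x)\<close>.\<close>

lemma quot_leD:
  assumes "a \<in> mv_carrier A" "b \<in> mv_carrier A" "mv_le Q (cls a) (cls b)"
  obtains i where "i \<in> I" "\<And>x. x \<in> X \<Longrightarrow> a x \<le> b x + i x"
proof -
  have "cls (\<ominus> a \<oplus> b) = cls (\<ominus> \<zero>)"
    using assms by (simp add: mv_le_def quot_neg quot_plus quot_zero neg_closed zero_closed)
  then have "(\<ominus> a \<oplus> b, \<ominus> \<zero>) \<in> mv_cong A I"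
    using assms by (simp add: cls_eq_iff neg_closed plus_closed zero_closed)
  then have "diff (\<ominus> a \<oplus> b) (\<ominus> \<zero>) \<in> I"
    by (simp add: cong_iff)
  moreover have "a x \<le> b x + diff (\<ominus> a \<oplus> b) (\<ominus> \<zero>) x" if "x \<in> X" for x
    using that assms by (auto simp: diff_apply neg_closed plus_closed zero_closed)
  ultimately show ?thesis by (rule that)
qed

text \<open>The class map respects zero, sum and order, so ideals pull back along it.\<close>

lemma ideal_vimage_quot:
  assumes M: "mv_ideal Q M"
  shows "mv_ideal A {h \<in> mv_carrier A. cls h \<in> M}" (is "mv_ideal A ?J")
  unfolding mv_ideal_def
proof (intro conjI ballI impI)
  show "\<zero> \<in> ?J" using M quot_zero by (simp add: mv_ideal_def zero_closed)
  show "a \<oplus> b \<in> ?J" if "a \<in> ?J" "b \<in> ?J" for a b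
  proof -
    have "mv_plus Q (cls a) (cls b) \<in> M" using that M unfolding mv_ideal_def by blast
    then show ?thesis using that by (simp add: quot_plus plus_closed)
  qed
  show "a \<in> ?J" if "a \<in> mv_carrier A" "b \<in> ?J" "mv_le A a b" for a b
  proof -
    have "mv_le Q (cls a) (cls b)" using that le_iff by (intro quot_leI) auto
    then have "cls a \<in> M" using that M quot_carrier unfolding mv_ideal_def by blast
    with that show ?thesis by simp
  qed
qed auto

lemma subset_vimage_quot:
  assumes M: "mv_ideal Q M"
  shows "I \<subseteq> {h \<in> mv_carrier A. cls h \<in> M}"
proof
  fix i assume i: "i \<in> I"
  then have ic: "i \<in> mv_carrier A" by (rule ideal_carrier[OF I])
  have "(i, \<zero>) \<in> mv_cong A I"
    using carrier_bounds(1)[OF ic] by (intro congI[OF ic zero_closed i]) auto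
  then have "cls i = cls \<zero>" using equiv_class_eq[OF equiv_cong] by blast
  then show "i \<in> {h \<in> mv_carrier A. cls h \<in> M}"
    using ic M quot_zero by (simp add: mv_ideal_def)
qed

text \<open>A class below that of \<open>b\<close> has its representatives below \<open>b\<close>
  only up to an error in \<open>I\<close>; the inclusion of \<open>I\<close> in \<open>J\<close>
  absorbs this error.\<close>

lemma ideal_image_quot:
  assumes J: "mv_ideal A J" and IJ: "I \<subseteq> J"
  shows "mv_ideal Q (cls ` J)"
  unfolding mv_ideal_def
proof (intro conjI ballI impI)
  show "cls ` J \<subseteq> mv_carrier Q"
    using ideal_carrier[OF J] unfolding quot_carrier by blast
  show "\<zero>\<^bsub>Q\<^esub> \<in> cls ` J" using ideal_zero[OF J] quot_zero by simp
next
  fix C D assume "C \<in> cls ` J" "D \<in> cls ` J"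
  then obtain a b where "a \<in> J" "b \<in> J" "C = cls a" "D = cls b" by blast
  then show "C \<oplus>\<^bsub>Q\<^esub> D \<in> cls ` J"
    using ideal_plus[OF J] ideal_carrier[OF J] by (simp add: quot_plus)
next
  fix C D assume "C \<in> mv_carrier Q" "D \<in> cls ` J" and le: "mv_le Q C D"
  then obtain a b where ab: "a \<in> mv_carrier A" "b \<in> J" "C = cls a" "D = cls b"
    unfolding quot_carrier by blast
  then obtain i where i: "i \<in> I" "\<And>x. x \<in> X \<Longrightarrow> a x \<le> b x + i x"
    using quot_leD[of a b] le ideal_carrier[OF J] by blast
  have "b \<oplus> i \<in> J" using ab i IJ ideal_plus[OF J] by blast
  then have "a \<in> J"
    using i carrier_bounds(2)[OF ab(1)] ab(1) by (auto intro: ideal_downward[OF J])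
  then show "C \<in> cls ` J" using ab by blast
qed

text \<open>The term \<open>\<ominus> (\<ominus> (k f) \<oplus> \<ominus> f)\<close> is the Lukasiewicz product of \<open>k f\<close> and \<open>f\<close>; it
  vanishes in the quotient for all \<open>k\<close> iff the class of \<open>f\<close> is zero or infinitesimal there.\<close>

lemma infinitesimal_mem_maximal_ideal:
  assumes f: "f \<in> mv_carrier A"
    and inf: "\<And>k. \<ominus> (\<ominus> (mv_mult A k f) \<oplus> \<ominus> f) \<in> I"
    and M: "mv_maximal_ideal Q M"
  shows "cls f \<in> M"
proof -
  define J where "J = {h \<in> mv_carrier A. cls h \<in> M}"
  define J' where "J' = ideal_adjoin J f"
  have M': "mv_ideal Q M" using M by (simp add: mv_maximal_ideal_def mv_proper_ideal_def)
  have J: "mv_ideal A J" "I \<subseteq> J"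
    unfolding J_def using ideal_vimage_quot[OF M'] subset_vimage_quot[OF M'] by auto
  have J': "mv_ideal A J'" "J \<subseteq> J'" "f \<in> J'"
    unfolding J'_def using ideal_ideal_adjoin subset_ideal_adjoin mem_ideal_adjoin J(1) f by auto
  have idQ: "mv_ideal Q (cls ` J')"
    using J J' by (intro ideal_image_quot) auto
  have "M \<subseteq> cls ` J"
    using M' unfolding J_def mv_ideal_def quot_carrier by blast
  then have sub: "M \<subseteq> cls ` J'" using J'(2) by blast
  show ?thesis
  \<comment> \<open>By maximality the image of \<open>J'\<close> is either \<open>M\<close>, which
    then contains the class of \<open>f\<close>, or the whole quotient. In the second case the top
    class has a representative in \<open>J'\<close>, and infinitesimality forces \<open>f\<close>
    into \<open>J\<close> itself.\<close>
  proof (cases "cls ` J' = mv_carrier Q")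
    case False
    then have "cls ` J' = M"
      using M idQ sub by (auto simp: mv_maximal_ideal_def mv_proper_ideal_def)
    then show ?thesis using J'(3) by blast
  next
    case True
    have one: "\<ominus> \<zero> \<in> mv_carrier A" by (simp add: neg_closed zero_closed)
    then obtain h where h: "h \<in> J'" "cls (\<ominus> \<zero>) = cls h"
      using True unfolding quot_carrier by blast
    have hc: "h \<in> mv_carrier A" using h J' ideal_carrier by blast
    have "mv_le Q (cls (\<ominus> \<zero>)) (cls h)"
      unfolding h(2) by (rule quot_leI[OF hc hc]) simp
    then obtain i where i: "i \<in> I" and "\<And>x. x \<in> X \<Longrightarrow> (\<ominus> \<zero>) x \<le> h x + i x"
      using quot_leD[OF one hc] by blast
    then have le: "1 \<le> h x + i x" if "x \<in> X" for x
      using that by fastforce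
    obtain b k where b: "b \<in> J" "\<And>x. x \<in> X \<Longrightarrow> h x \<le> b x + real k * f x"
      using h(1) unfolding J'_def ideal_adjoin_def by blast
    \<comment> \<open>The Lukasiewicz product of \<open>f\<close> with
      \<open>1 \<le> b + i + k f\<close> shows that \<open>f\<close> lies below \<open>b + i\<close>
      plus the product of \<open>k f\<close> and \<open>f\<close>. All three summands are in
      \<open>J\<close>.\<close>
    define c where "c = (b \<oplus> i) \<oplus> \<ominus> (\<ominus> (mv_mult A k f) \<oplus> \<ominus> f)"
    have "c \<in> J"
      unfolding c_def using b i inf J(2) by (intro ideal_plus[OF J(1)]) auto
    moreover have "f x \<le> c x" if "x \<in> X" for x
    proof -
      have "b \<in> mv_carrier A" "i \<in> mv_carrier A"
        using ideal_carrier[OF J(1)] b i J by auto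
      then have nn: "0 \<le> b x" "0 \<le> i x" using carrier_bounds that by auto
      define K where "K = real k * f x"
      have "c x = min 1 (min 1 (b x + i x) + (1 - min 1 (2 - min 1 K - f x)))"
        unfolding c_def using that by (simp add: mult_apply[OF f that] K_def algebra_simps)
      moreover have "1 \<le> b x + K + i x"
        using le[OF that] b(2)[OF that] unfolding K_def by linarith
      ultimately show ?thesis
        using nn carrier_bounds[OF f that] by linarith
    qed
    ultimately have "f \<in> J" using f J(1) by (blast intro: ideal_downward)
    then show ?thesis by (simp add: J_def)
  qed
qed

end

text \<open>The class of \<open>f\<close> modulo \<open>g\<close> is nonzero by \<open>nmem\<close>,
  yet it lies in every maximal ideal of the quotient by \<open>inf\<close>.\<close>

lemma not_strongly_semisimpleI:
  assumes f: "f \<in> mv_carrier A" and g: "g \<in> mv_carrier A"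
    and nmem: "f \<notin> mv_principal A g"
    and inf: "\<And>k. \<ominus> (\<ominus> (mv_mult A k f) \<oplus> \<ominus> f) \<in> mv_principal A g"
  shows "\<not> mv_strongly_semisimple A"
proof
  assume "mv_strongly_semisimple A"
  let ?I = "mv_principal A g"
  have I: "mv_ideal A ?I" by (rule ideal_principal[OF g])
  let ?C = "mv_cong A ?I `` {f}"
  have "?C \<in> {C \<in> mv_carrier (mv_quot A ?I). \<forall>M. mv_maximal_ideal (mv_quot A ?I) M \<longrightarrow> C \<in> M}"
  proof (intro CollectI conjI allI impI)
    show "?C \<in> mv_carrier (mv_quot A ?I)"
      unfolding quot_carrier[OF I] using f by (rule imageI)
    show "?C \<in> M" if "mv_maximal_ideal (mv_quot A ?I) M" for M
      using I f inf that by (rule infinitesimal_mem_maximal_ideal)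
  qed
  also have "\<dots> = {mv_zero (mv_quot A ?I)}"
    using \<open>mv_strongly_semisimple A\<close> g
    unfolding mv_strongly_semisimple_def mv_semisimple_def by (rule bspec)
  finally have "?C = mv_zero (mv_quot A ?I)" by (rule singletonD)
  then have "(f, \<zero>) \<in> mv_cong A ?I"
    using cls_eq_iff[OF I f zero_closed] quot_zero[OF I] by simp
  then have "diff f \<zero> \<in> ?I" by (simp add: cong_iff)
  then have "f \<in> ?I"
    by (rule ideal_downward[OF I]) (auto simp: f diff_apply zero_closed)
  with nmem show False by simp
qed

end

section \<open>McNaughton functions obtained from integer piecewise affine functions\<close>

lemma mv_function_algebra_mcnaughton_algebra:
  assumes "X \<subseteq> unit_cube"
  shows "mv_function_algebra (mcnaughton_algebra X) X"
proof -
  interpret mv_algebra "mcnaughton_algebra X"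
    by (rule mv_algebra_mcnaughton_algebra[OF assms])
  have "f x \<in> {0..1}" if "f \<in> mcnaughton" "x \<in> X" for f x
    using that assms by (auto simp: mcnaughton_def PiE_iff subset_iff)
  then show ?thesis
    by unfold_locales (auto simp: mcnaughton_algebra_def)
qed

text \<open>The untruncated, globally defined counterpart of \<open>mcnaughton\<close>. It allows
  free use of sums and maxima; truncation and restriction to the cube are postponed to
  \<open>restrict_min_one_mcnaughton\<close>.\<close>

definition int_piecewise_affine :: "(real ^ 'n \<Rightarrow> real) \<Rightarrow> bool" where
  "int_piecewise_affine f \<longleftrightarrow> continuous_on UNIV f \<and>
     (\<exists>P. finite P \<and> (\<forall>p\<in>P. integer_affine p) \<and> (\<forall>x. \<exists>p\<in>P. f x = p x))"

lemma int_piecewise_affine_continuous: "int_piecewise_affine f \<Longrightarrow> continuous_on S f"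
  unfolding int_piecewise_affine_def using continuous_on_subset by blast

lemma int_piecewise_affine_affine:
  assumes "integer_affine p"
  shows "int_piecewise_affine p"
proof -
  obtain c d where p: "p = (\<lambda>x. (\<Sum>i\<in>UNIV. of_int (c i) * x $ i) + of_int d)"
    using assms unfolding integer_affine_def by blast
  have "continuous_on UNIV p" unfolding p by (intro continuous_intros)
  then show ?thesis
    using assms unfolding int_piecewise_affine_def by (intro conjI exI[of _ "{p}"]) auto
qed

lemma int_piecewise_affine_add:
  assumes "int_piecewise_affine f" "int_piecewise_affine g"
  shows "int_piecewise_affine (\<lambda>x. f x + g x)"
proof -
  obtain P P' where P: "finite P" "\<forall>p\<in>P. integer_affine p" "\<forall>x. \<exists>p\<in>P. f x = p x"
    and P': "finite P'" "\<forall>p\<in>P'. integer_affine p" "\<forall>x. \<exists>p\<in>P'. g x = p x"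
    using assms unfolding int_piecewise_affine_def by metis
  let ?R = "(\<lambda>(p, q) x. p x + q x) ` (P \<times> P')"
  have "\<exists>r\<in>?R. f x + g x = r x" for x
    using P(3)[rule_format, of x] P'(3)[rule_format, of x] by force
  moreover have "finite ?R" "\<forall>r\<in>?R. integer_affine r"
    using P P' by (auto intro: integer_affine_add)
  moreover have "continuous_on UNIV (\<lambda>x. f x + g x)"
    using assms by (auto intro!: continuous_intros simp: int_piecewise_affine_def)
  ultimately show ?thesis
    unfolding int_piecewise_affine_def by blast
qed

lemma int_piecewise_affine_max:
  assumes "int_piecewise_affine f" "int_piecewise_affine g"
  shows "int_piecewise_affine (\<lambda>x. max (f x) (g x))"
proof -
  obtain P P' where P: "finite P" "\<forall>p\<in>P. integer_affine p" "\<forall>x. \<exists>p\<in>P. f x = p x"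
    and P': "finite P'" "\<forall>p\<in>P'. integer_affine p" "\<forall>x. \<exists>p\<in>P'. g x = p x"
    using assms unfolding int_piecewise_affine_def by metis
  have "\<exists>r\<in>P \<union> P'. max (f x) (g x) = r x" for x
    using P(3)[rule_format, of x] P'(3)[rule_format, of x] by (auto simp: max_def)
  moreover have "continuous_on UNIV (\<lambda>x. max (f x) (g x))"
    using assms by (auto intro!: continuous_intros simp: int_piecewise_affine_def)
  ultimately show ?thesis
    unfolding int_piecewise_affine_def using P P'
    by (intro conjI exI[of _ "P \<union> P'"]) auto
qed

lemma int_piecewise_affine_sum:
  assumes "finite S" "\<And>i. i \<in> S \<Longrightarrow> int_piecewise_affine (f i)"
  shows "int_piecewise_affine (\<lambda>x. \<Sum>i\<in>S. f i x)"
  using assms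
proof (induction S rule: finite_induct)
  case empty
  then show ?case using int_piecewise_affine_affine[OF integer_affine_const[of 0]] by simp
qed (auto intro: int_piecewise_affine_add)

lemma integer_affine_uminus: "integer_affine p \<Longrightarrow> integer_affine (\<lambda>x. - p x)"
  using integer_affine_add[OF integer_affine_neg[of p] integer_affine_const[of "-1"]] by simp

lemma int_piecewise_affine_abs:
  assumes "integer_affine p"
  shows "int_piecewise_affine (\<lambda>x. \<bar>p x\<bar>)"
  unfolding abs_real_def abs_if
  using int_piecewise_affine_max[OF int_piecewise_affine_affine[OF assms]
      int_piecewise_affine_affine[OF integer_affine_uminus[OF assms]]]
  by (rule back_subst[of int_piecewise_affine]) (auto simp: max_def)

text \<open>The factor \<open>D\<close> clears the denominator of \<open>a $ i\<close>, which makes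
  the constant term an integer.\<close>

lemma integer_affine_coord_diff:
  assumes "of_int D * a $ i \<in> \<int>"
  shows "integer_affine (\<lambda>y. of_int k * (of_int D * (y $ i - a $ i)))"
proof -
  obtain d where d: "of_int D * a $ i = of_int d" using assms by (auto elim: Ints_cases)
  have "of_int k * (of_int D * (y $ i - a $ i)) =
    (\<Sum>j\<in>UNIV. of_int (if j = i then k * D else 0) * y $ j) + of_int (- k * d)" for y
  proof -
    have "(\<Sum>j\<in>UNIV. of_int (if j = i then k * D else 0) * y $ j)
        = (\<Sum>j\<in>UNIV. if j = i then of_int (k * D) * y $ j else 0)"
      by (intro sum.cong) auto
    also have "\<dots> = of_int (k * D) * y $ i" by simp
    finally show ?thesis using d by (simp add: algebra_simps flip: d)
  qed
  then show ?thesis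
    unfolding integer_affine_def
    by (intro exI[of _ "\<lambda>j. if j = i then k * D else 0"] exI[of _ "- k * d"]) blast
qed

text \<open>Truncation adds only the constant 1 to the affine pieces.\<close>

lemma restrict_min_one_mcnaughton:
  assumes "int_piecewise_affine f" "\<And>y. 0 \<le> f y"
  shows "(\<lambda>y\<in>unit_cube. min 1 (f y)) \<in> mcnaughton"
proof -
  obtain P where P: "finite P" "\<forall>p\<in>P. integer_affine p" "\<forall>x. \<exists>p\<in>P. f x = p x"
    using assms unfolding int_piecewise_affine_def by metis
  let ?P = "insert (\<lambda>_. 1) P"
  have "\<exists>p\<in>?P. min 1 (f x) = p x" for x
    using P(3)[rule_format, of x] by (auto simp: min_def)
  moreover have "finite ?P" "\<forall>p\<in>?P. integer_affine p"
    using P integer_affine_const[of 1] by auto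
  moreover have "continuous_on unit_cube (\<lambda>y\<in>unit_cube. min 1 (f y))"
    using int_piecewise_affine_continuous[OF assms(1)]
    by (auto intro!: continuous_intros cong: continuous_on_cong)
  ultimately show ?thesis
    unfolding mcnaughton_def using assms(2)
    by (auto simp: PiE_iff simp del: insert_iff intro!: exI[of _ ?P])
qed

section \<open>Rational points and rational directions\<close>

lemma rational_point_common_denominator:
  fixes a :: "real ^ 'n"
  assumes "rational_point a"
  obtains D :: int where "D > 0" "\<And>i. of_int D * a $ i \<in> \<int>"
proof -
  have "\<exists>d>0. of_int d * a $ i \<in> \<int>" for i
  proof -
    obtain m k where "k > 0" "a $ i = of_int m / of_int k"
      using assms unfolding rational_point_def by (metis Rats_cases')
    then show ?thesis by (intro exI[of _ k]) auto
  qed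
  then obtain d :: "'n \<Rightarrow> int" where d: "\<And>i. d i > 0" "\<And>i. of_int (d i) * a $ i \<in> \<int>"
    by metis
  \<comment> \<open>The product of the denominators of all coordinates serves as common
    denominator.\<close>
  have "of_int (prod d UNIV) * a $ i \<in> \<int>" for i
  proof -
    have "of_int (prod d UNIV) * a $ i = of_int (prod d (UNIV - {i})) * (of_int (d i) * a $ i)"
      by (subst prod.remove[of UNIV i]) (auto simp: mult_ac)
    also have "\<dots> \<in> \<int>" by (intro Ints_mult Ints_of_int d(2))
    finally show ?thesis .
  qed
  then show ?thesis using d(1) by (intro that[of "prod d UNIV"]) (auto intro: prod_pos)
qed

text \<open>Of two distinct rational points on the line through 0 and \<open>u\<close>, one is
  nonzero; clearing its denominators gives an integer vector. The sign of \<open>r\<close> is left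
  open.\<close>

lemma rational_vector_integer_multiple:
  fixes u :: "real ^ 'n"
  assumes "rational_vector u"
  obtains c :: "'n \<Rightarrow> int" and r :: real where "r \<noteq> 0" "\<And>i. of_int (c i) = r * u $ i"
proof -
  obtain t where t: "t \<noteq> 0" "rational_point (t *\<^sub>R u)"
    using assms unfolding rational_vector_def by (metis (no_types, lifting) imageE)
  then obtain D :: int where D: "D > 0" "\<And>i. of_int D * (t *\<^sub>R u) $ i \<in> \<int>"
    using rational_point_common_denominator by blast
  then obtain c :: "'n \<Rightarrow> int" where "\<And>i. of_int D * (t *\<^sub>R u) $ i = of_int (c i)"
    unfolding Ints_def by (simp add: image_iff) metis
  then show ?thesis using t(1) D(1) by (intro that[of "of_int D * t" c]) (auto simp: mult.assoc)
qed

text \<open>If \<open>F\<close> vanishes at the only zero \<open>a\<close> of \<open>G\<close> in \<open>X\<close>, then by compactness of \<open>X\<close> the class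
  of \<open>F\<close> is infinitesimal modulo the ideal generated by \<open>G\<close>.\<close>

lemma mcnaughton_algebra_not_strongly_semisimpleI:
  fixes X :: "(real ^ 'n) set"
  assumes "closed X" "X \<subseteq> unit_cube" "a \<in> X"
    and F: "int_piecewise_affine F" "\<And>y. 0 \<le> F y" "F a = 0"
    and G: "int_piecewise_affine G" "\<And>y. 0 \<le> G y" "\<And>y. y \<in> X \<Longrightarrow> G y = 0 \<Longrightarrow> y = a"
    and unbounded: "\<And>k::nat. \<exists>y\<in>X. real k * min 1 (G y) < min 1 (F y)"
  shows "\<not> mv_strongly_semisimple (mcnaughton_algebra X)"
proof -
  interpret mv_function_algebra "mcnaughton_algebra X" X
    by (rule mv_function_algebra_mcnaughton_algebra[OF assms(2)])
  have "bounded (unit_cube :: (real ^ 'n) set)"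
    by (rule bounded_subset[OF bounded_cbox[of 0 1]])
      (auto simp: unit_cube_def mem_box_cart)
  then have X: "compact X"
    using assms(1,2) bounded_subset by (auto simp: compact_eq_bounded_closed)
  let ?A = "mcnaughton_algebra X"
  have in_carrier: "(\<lambda>y\<in>X. min 1 (h y)) \<in> mv_carrier ?A"
    if "int_piecewise_affine h" "\<And>y. 0 \<le> h y" for h
  proof -
    have "(\<lambda>y\<in>X. min 1 (h y)) = restrict (\<lambda>y\<in>unit_cube. min 1 (h y)) X"
      using assms(2) by (auto simp: restrict_def fun_eq_iff)
    then show ?thesis
      using restrict_min_one_mcnaughton[OF that]
      unfolding mcnaughton_algebra_def by (simp only: mv_struct.simps) blast
  qed
  let ?f = "\<lambda>y\<in>X. min 1 (F y)" and ?g = "\<lambda>y\<in>X. min 1 (G y)"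
  have f: "?f \<in> mv_carrier ?A" and g: "?g \<in> mv_carrier ?A"
    using in_carrier F G by auto
  show ?thesis
  proof (rule not_strongly_semisimpleI[OF f g])
    show "?f \<notin> mv_principal ?A ?g"
    proof
      assume "?f \<in> mv_principal ?A ?g"
      then obtain k where k: "\<forall>y\<in>X. ?f y \<le> real k * ?g y"
        using mem_principal_iff[OF g] by blast
      obtain y where "y \<in> X" "real k * min 1 (G y) < min 1 (F y)"
        using unbounded by blast
      with k show False by fastforce
    qed
    fix k
    let ?p = "\<ominus>\<^bsub>?A\<^esub> (\<ominus>\<^bsub>?A\<^esub> (mv_mult ?A k ?f) \<oplus>\<^bsub>?A\<^esub> \<ominus>\<^bsub>?A\<^esub> ?f)"
    have p: "?p \<in> mv_carrier ?A"
      by (intro neg_closed plus_closed mult_closed f)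
    \<comment> \<open>Outside \<open>K\<close> the product of \<open>k\<close> times
      \<open>?f\<close> with \<open>?f\<close> vanishes. As \<open>F a = 0\<close>, the point
      \<open>a\<close> is not in \<open>K\<close>, so \<open>G\<close> has no zero there.\<close>
    define K where "K = X \<inter> {y. 1 \<le> real (Suc k) * F y}"
    have "closed {y. 1 \<le> real (Suc k) * F y}"
      using int_piecewise_affine_continuous[OF F(1)]
      by (intro closed_Collect_le continuous_intros) auto
    then have K: "compact K"
      unfolding K_def using X by (rule compact_Int_closed[rotated])
    have pos: "0 < min 1 (G y)" if "y \<in> K" for y
      using that F(3) G(2)[of y] G(3)[of y] by (cases "G y = 0") (auto simp: K_def)
    \<comment> \<open>The minimum of the truncated \<open>G\<close> over the compact set
      \<open>K\<close>; if \<open>K\<close> is empty, any positive number will do.\<close>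
    obtain e where e: "e > 0" "\<And>y. y \<in> K \<Longrightarrow> e \<le> min 1 (G y)"
    proof (cases "K = {}")
      case False
      have "continuous_on K (\<lambda>y. min 1 (G y))"
        using int_piecewise_affine_continuous[OF G(1)] by (intro continuous_intros)
      then obtain z where "z \<in> K" "\<forall>y\<in>K. min 1 (G z) \<le> min 1 (G y)"
        using continuous_attains_inf[OF K False] by blast
      with pos show ?thesis by (intro that[of "min 1 (G z)"]) auto
    qed (auto intro: that[of 1])
    \<comment> \<open>With this \<open>m\<close> the multiple of \<open>?g\<close> exceeds 1 on
      \<open>K\<close>, and 1 bounds every value of the product.\<close>
    obtain m :: nat where m: "1 < real m * e"
      using reals_Archimedean3[OF e(1)] by blast
    have "?p y \<le> real m * ?g y" if y: "y \<in> X" for y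
    proof (cases "y \<in> K")
      case True
      have "?p y \<le> 1" by (rule carrier_bounds[OF p y])
      also have "1 \<le> real m * e" using m by simp
      also have "\<dots> \<le> real m * min 1 (G y)" using e(2)[OF True] by (rule mult_left_mono) simp
      finally show ?thesis using y by simp
    next
      case False
      then have "real k * F y + F y < 1" using y by (simp add: K_def algebra_simps)
      moreover have "real k * min 1 (F y) \<le> real k * F y" by (intro mult_left_mono) auto
      ultimately have "mv_mult ?A k ?f y + ?f y \<le> 1"
        using y F(2)[of y] by (simp only: mult_apply[OF f y] restrict_apply' min_le_iff_disj)
      then have "?p y = 0" using y by (simp del: restrict_apply)
      then show ?thesis using y G(2)[of y] by simp
    qed
    with p show "?p \<in> mv_principal ?A ?g"
      using mem_principal_iff[OF g] by blast
  qed
qed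

section \<open>Construction of \<open>F\<close> and \<open>G\<close> from a rational outgoing
  tangent vector\<close>

theorem theorem3p3:
  fixes X :: "(real ^ 'n) set" and x u :: "real ^ 'n"
  assumes "X \<noteq> {}" and "closed X" and "X \<subseteq> unit_cube"
    and "x \<in> X" and "rational_point x"
    and "norm u = 1" and "rational_vector u"
    and "bs_tangent X x u" and "outgoing X x u"
  shows "\<not> mv_strongly_semisimple (mcnaughton_algebra X)"
proof -
  obtain D :: int where D: "D > 0" "\<And>i. of_int D * x $ i \<in> \<int>"
    using rational_point_common_denominator[OF assms(5)] by blast
  obtain c :: "'n \<Rightarrow> int" and r where c: "r \<noteq> 0" "\<And>i. of_int (c i) = r * u $ i"
    using rational_vector_integer_multiple[OF assms(7)] by metis
  obtain l where l: "l > 0" "convex hull {x, x + l *\<^sub>R u} \<inter> X = {x}"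
    using assms(9) unfolding outgoing_def by blast
  obtain s where s: "\<And>i. s i \<in> X" "\<And>i. s i \<noteq> x" "s \<longlonglongrightarrow> x"
    "(\<lambda>i. (s i - x) /\<^sub>R norm (s i - x)) \<longlonglongrightarrow> u"
    using assms(8) unfolding bs_tangent_def by blast
  \<comment> \<open>Coordinate \<open>j\<close> measures the position along the line in direction
    \<open>u\<close>; the sign \<open>\<sigma>\<close> orients it so that it increases along
    \<open>u\<close>.\<close>
  obtain j where j: "u $ j \<noteq> 0"
    using assms(6) by (metis norm_zero vec_eq_iff zero_index zero_neq_one)
  define \<sigma> :: int where "\<sigma> = (if u $ j > 0 then 1 else -1)"
  have \<sigma>: "of_int \<sigma> * u $ j = \<bar>u $ j\<bar>" by (auto simp: \<sigma>_def)
  \<comment> \<open>At the far end of the outgoing segment \<open>\<sigma>\<close> times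
    \<open>D\<close> times the \<open>j\<close>-th displacement is
    \<open>D * l * \<bar>u $ j\<bar>\<close>. Thus \<open>N\<close> makes the cut-off in
    \<open>G\<close> exclude points at distance \<open>l\<close> or more along the ray.\<close>
  obtain N :: nat where N: "1 < real N * (of_int D * l * \<bar>u $ j\<bar>)"
    using reals_Archimedean3[of "of_int D * l * \<bar>u $ j\<bar>"] D(1) l(1) j by force
  define e where "e = (\<lambda>i y. of_int D * (y $ i - x $ i))"
  have e_affine: "integer_affine (\<lambda>y. of_int k * e i y)" for k i
    unfolding e_def by (rule integer_affine_coord_diff[OF D(2)])
  text \<open>\<open>H\<close> is positively homogeneous and vanishes exactly on the ray spanned by \<open>u\<close>; the second
    summand of \<open>G\<close> cuts the zero set down to a subsegment of the outgoing segment.\<close>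
  define H where "H = (\<lambda>v::real^'n.
    (\<Sum>i\<in>UNIV. \<bar>of_int (c j) * v $ i + of_int (- c i) * v $ j\<bar>) + max 0 (of_int (- \<sigma>) * v $ j))"
  \<comment> \<open>\<open>F\<close> is \<open>D\<close> times the l1-distance from
    \<open>x\<close>.\<close>
  define F where "F = (\<lambda>y. \<Sum>i\<in>UNIV. \<bar>e i y\<bar>)"
  define G where "G = (\<lambda>y. of_int D * H (y - x) + max 0 (of_int (int N * \<sigma>) * e j y - 1))"
  have H_nonneg: "0 \<le> H v" for v
    unfolding H_def by (intro add_nonneg_nonneg sum_nonneg) auto
  have H_scale: "H (t *\<^sub>R v) = t * H v" if "t \<ge> 0" for t v
  proof -
    have "\<bar>of_int (c j) * (t *\<^sub>R v) $ i + of_int (- c i) * (t *\<^sub>R v) $ j\<bar>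
        = t * \<bar>of_int (c j) * v $ i + of_int (- c i) * v $ j\<bar>" for i
    proof -
      have "of_int (c j) * (t *\<^sub>R v) $ i + of_int (- c i) * (t *\<^sub>R v) $ j
          = t * (of_int (c j) * v $ i + of_int (- c i) * v $ j)"
        by (simp add: algebra_simps)
      then show ?thesis using that by (simp only: abs_mult abs_of_nonneg)
    qed
    moreover have "max 0 (of_int (- \<sigma>) * (t *\<^sub>R v) $ j) = t * max 0 (of_int (- \<sigma>) * v $ j)"
      using max_mult_distrib_left[of t 0 "of_int (- \<sigma>) * v $ j"] that
      by (simp add: mult.left_commute)
    ultimately show ?thesis
      unfolding H_def by (simp only: sum_distrib_left distrib_left)
  qed
  \<comment> \<open>Since \<open>c\<close> is proportional to \<open>u\<close>, all the 2 by 2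
    minors in the sum vanish, and \<open>\<sigma>\<close> makes the argument
    \<open>- \<sigma> * u $ j\<close> negative.\<close>
  have H_u: "H u = 0"
    using \<sigma> by (simp add: H_def c(2))
  have H_cont: "isCont H v" for v
    unfolding H_def by (intro continuous_intros)
  \<comment> \<open>Homogeneity moves the factor \<open>D\<close> inside \<open>H\<close>. There it
    turns \<open>y - x\<close>, whose constant terms are only rational, into the integer affine
    functions \<open>e i\<close>.\<close>
  have G_eq: "G = (\<lambda>y. ((\<Sum>i\<in>UNIV. \<bar>of_int (c j) * e i y + of_int (- c i) * e j y\<bar>)
      + max 0 (of_int (- \<sigma>) * e j y)) + max 0 (of_int (int N * \<sigma>) * e j y + of_int (-1)))"
  proof
    fix y
    have "of_int D * H (y - x) = H (of_int D *\<^sub>R (y - x))"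
      using H_scale[of "of_int D"] D(1) by simp
    then show "G y = ((\<Sum>i\<in>UNIV. \<bar>of_int (c j) * e i y + of_int (- c i) * e j y\<bar>)
      + max 0 (of_int (- \<sigma>) * e j y)) + max 0 (of_int (int N * \<sigma>) * e j y + of_int (-1))"
      by (simp add: G_def H_def e_def)
  qed
  show ?thesis
  proof (rule mcnaughton_algebra_not_strongly_semisimpleI[OF assms(2,3,4)])
    have "integer_affine (e i)" for i using e_affine[of 1 i] by simp
    then show "int_piecewise_affine F"
      unfolding F_def by (intro int_piecewise_affine_sum int_piecewise_affine_abs) auto
    show "0 \<le> F y" for y unfolding F_def by (intro sum_nonneg) auto
    show "F x = 0" by (simp add: F_def e_def)
    have max0: "int_piecewise_affine (\<lambda>y. max 0 (p y))" if "integer_affine p" for p :: "real^'n \<Rightarrow> real"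
      using int_piecewise_affine_max[OF int_piecewise_affine_affine[OF integer_affine_const[of 0]]
          int_piecewise_affine_affine[OF that]] by simp
    show "int_piecewise_affine G"
      unfolding G_eq
      by (intro int_piecewise_affine_add int_piecewise_affine_sum int_piecewise_affine_abs max0
          integer_affine_add e_affine integer_affine_const finite)
    show "0 \<le> G y" for y
      unfolding G_def using D(1) H_nonneg by simp
  next
    fix y assume y: "y \<in> X" "G y = 0"
    have H0: "H (y - x) = 0" and le: "real N * (of_int \<sigma> * e j y) \<le> 1"
    proof -
      have "0 \<le> of_int D * H (y - x)" using D(1) H_nonneg by simp
      with y(2) have "of_int D * H (y - x) = 0" "max 0 (of_int (int N * \<sigma>) * e j y - 1) = 0"
        unfolding G_def by linarith+
      then show "H (y - x) = 0" "real N * (of_int \<sigma> * e j y) \<le> 1"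
        using D(1) by (auto simp: mult.assoc max_def split: if_splits)
    qed
    have "0 \<le> (\<Sum>i\<in>UNIV. \<bar>of_int (c j) * (y - x) $ i + of_int (- c i) * (y - x) $ j\<bar>)"
      by (intro sum_nonneg) auto
    with H0 have line: "(\<Sum>i\<in>UNIV. \<bar>of_int (c j) * (y - x) $ i + of_int (- c i) * (y - x) $ j\<bar>) = 0"
      and "max 0 (of_int (- \<sigma>) * (y - x) $ j) = 0"
      unfolding H_def by linarith+
    then have ray: "0 \<le> of_int \<sigma> * (y - x) $ j"
      by (auto simp: max_def split: if_splits)
    define t where "t = (y - x) $ j / u $ j"
    \<comment> \<open>The vanishing sum of minors makes \<open>y - x\<close> proportional to
      \<open>c\<close>, hence to \<open>u\<close>; coordinate \<open>j\<close> determines the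
      factor.\<close>
    have yx: "y = x + t *\<^sub>R u"
    proof (rule vec_eq_iff[THEN iffD2], rule allI)
      fix i
      have "of_int (c j) * (y - x) $ i + of_int (- c i) * (y - x) $ j = 0"
        using line by (subst (asm) sum_nonneg_eq_0_iff) auto
      then have "r * (u $ j * (y - x) $ i) = r * (u $ i * (y - x) $ j)"
        by (simp add: c(2) mult.assoc)
      then have "u $ j * (y - x) $ i = u $ i * (y - x) $ j" using c(1) by simp
      then show "y $ i = (x + t *\<^sub>R u) $ i" using j by (simp add: t_def field_simps)
    qed
    have tj: "of_int \<sigma> * (y - x) $ j = t * \<bar>u $ j\<bar>"
      using \<sigma> j by (simp add: yx mult.left_commute)
    then have t0: "0 \<le> t" using ray j by (simp add: zero_le_mult_iff)
    have "of_int \<sigma> * e j y = of_int D * (t * \<bar>u $ j\<bar>)"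
      using tj by (simp add: e_def mult.left_commute)
    \<comment> \<open>The left side is at most 1 by the cut-off in \<open>G\<close>, the right side
      exceeds 1 by the choice of \<open>N\<close>. So \<open>y\<close> lies on the outgoing segment,
      which meets \<open>X\<close> only at \<open>x\<close>.\<close>
    then have "real N * (of_int D * t * \<bar>u $ j\<bar>) < real N * (of_int D * l * \<bar>u $ j\<bar>)"
      using le N by (simp add: mult.assoc)
    then have "t \<le> l"
      using D(1) by (metis (no_types, opaque_lifting) abs_ge_zero linorder_le_cases linorder_not_less
          mult_left_mono mult_right_mono of_int_0_le_iff of_nat_0_le_iff order_less_imp_le)
    then have "y \<in> closed_segment x (x + l *\<^sub>R u)"
      unfolding in_segment using t0 l(1) yx
      by (intro exI[of _ "t / l"]) (auto simp: algebra_simps)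
    then show "y = x" using l(2) y(1) by (auto simp: segment_convex_hull)
  next
    fix k :: nat
    define n where "n = (\<lambda>i. norm (s i - x))"
    define v where "v = (\<lambda>i. (s i - x) /\<^sub>R n i)"
    have n_pos: "n i > 0" for i using s(2) by (simp add: n_def)
    have v: "v \<longlonglongrightarrow> u" using s(4) by (simp add: v_def n_def)
    have sv: "s i - x = n i *\<^sub>R v i" for i using n_pos[of i] by (simp add: v_def)
    have n0: "n \<longlonglongrightarrow> 0"
      unfolding n_def using s(3) LIM_zero tendsto_norm_zero by blast
    have "(\<lambda>i. real k * H (v i) * of_int D) \<longlonglongrightarrow> real k * H u * of_int D"
      by (intro tendsto_intros isCont_tendsto_compose[OF H_cont v])
    then have ev1: "eventually (\<lambda>i. real k * H (v i) * of_int D < 1) sequentially"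
      by (rule order_tendstoD(2)) (simp add: H_u)
    \<comment> \<open>Near \<open>x\<close> the cut-off summand of \<open>G\<close> is zero, because
      \<open>e j x = 0\<close>.\<close>
    have "(\<lambda>i. of_int (int N * \<sigma>) * e j (s i)) \<longlonglongrightarrow> of_int (int N * \<sigma>) * e j x"
      unfolding e_def by (intro tendsto_intros s(3))
    then have ev2: "eventually (\<lambda>i. of_int (int N * \<sigma>) * e j (s i) < 1) sequentially"
      by (intro order_tendstoD(2)) (auto simp: e_def)
    have ev3: "eventually (\<lambda>i. n i < 1) sequentially"
      using n0 by (intro order_tendstoD(2)) auto
    obtain i where i: "real k * H (v i) * of_int D < 1" "of_int (int N * \<sigma>) * e j (s i) < 1"
      "n i < 1"
      using eventually_happens'[OF _ eventually_conj[OF ev1 eventually_conj[OF ev2 ev3]]] by auto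
    \<comment> \<open>The Euclidean norm is at most the l1-norm, and \<open>D\<close> is at least 1
      as a positive integer. The bound \<open>n i < 1\<close> lets this estimate survive the
      truncation of \<open>F\<close>.\<close>
    have "n i \<le> (\<Sum>m\<in>UNIV. \<bar>(s i - x) $ m\<bar>)" unfolding n_def by (rule norm_le_l1_cart)
    also have "\<dots> \<le> F (s i)"
    proof (unfold F_def, rule sum_mono)
      fix m
      have "1 * \<bar>(s i - x) $ m\<bar> \<le> of_int D * \<bar>(s i - x) $ m\<bar>"
        using D(1) by (intro mult_right_mono) auto
      then show "\<bar>(s i - x) $ m\<bar> \<le> \<bar>e m (s i)\<bar>"
        using D(1) by (simp add: e_def abs_mult)
    qed
    finally have F_ge: "n i \<le> min 1 (F (s i))" using i(3) by simp
    have "G (s i) = of_int D * (n i * H (v i))"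
      using i(2) n_pos[of i] by (simp add: G_def sv H_scale)
    then have "real k * min 1 (G (s i)) \<le> real k * (of_int D * (n i * H (v i)))"
      by (intro mult_left_mono) auto
    also have "\<dots> = n i * (real k * H (v i) * of_int D)" by (simp add: algebra_simps)
    also have "\<dots> < n i * 1" using i(1) n_pos by (intro mult_strict_left_mono)
    finally show "\<exists>y\<in>X. real k * min 1 (G y) < min 1 (F y)"
      using F_ge s(1) by (intro bexI[of _ "s i"]) auto
  qed
qed

end
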